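(* Let $n\ge 1$ and take $m=2$, so that the group is the hyperoctahedral group $B_n=C_2\wr S_n$. Then the flag major index is equidistributed with the length function on $B_n$; that is, for every integer $k\ge 0$, $$\#\{\pi\in B_n : \text{flag-major}(\pi)=k\}=\#\{\pi\in B_n : \ell(\pi)=k\}.$$
   Context: $B_n=C_2\wr S_n$ is the group of signed permutations: bijections $\pi$ of $\{\pm1,\dots,\pm n\}$ with $\pi(-j)=-\pi(j)$, with product given by composition $(\pi\sigma)(j)=\pi(\sigma(j))$. Its Coxeter generators are $s_0,s_1,\dots,s_{n-1}$, where $s_0(1)=-1$ and $s_0(j)=j$ for $2\le j\le n$, and, for $1\le i<n$, $s_i$ exchanges $i$ and $i+1$ and fixes all other $j\in\{1,\dots,n\}$. The length $\ell(\pi)$ is the minimal number of factors in an expression of $\pi$ as a product of the generators $s_0,s_1,\dots,s_{n-1}$. Put $t_i:=s_i s_{i-1}\cdots s_1 s_0$ for $0\le i\le n-1$. Every $\pi\in B_n$ has a unique representation $\pi=t_{n-1}^{k_{n-1}}t_{n-2}^{k_{n-2}}\cdots t_1^{k_1}t_0^{k_0}$ with integers $0\le k_i<2(i+1)$ for all $i$. The flag major index is $\text{flag-major}(\pi):=\sum_{i=0}^{n-1}k_i$ for these $k_i$. *)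

theory Defs
  imports "HOL-Combinatorics.Permutations"
begin

text \<open>
  A signed permutation of \<open>{\<plusminus>1, \<dots>, \<plusminus>n}\<close> is represented by a total function on the integers that is
  the identity outside \<open>{\<plusminus>1, \<dots>, \<plusminus>n}\<close>, so that distinct functions are distinct group elements and
  the group operation is function composition.
\<close>

definition signed_perms :: "nat \<Rightarrow> (int \<Rightarrow> int) set" where
  "signed_perms n =
     {\<pi>. \<pi> permutes ({- int n..int n} - {0}) \<and>
         (\<forall>j \<in> {- int n..int n} - {0}. \<pi> (- j) = - \<pi> j)}"

text \<open>
  The generators do not depend on \<open>n\<close>. For \<open>i \<ge> 1\<close>, the second transposition is forced by
  \<open>s\<^sub>i (- j) = - s\<^sub>i j\<close>.
\<close>

definition cox_gen :: "nat \<Rightarrow> int \<Rightarrow> int" where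
  "cox_gen i =
     (if i = 0 then transpose 1 (- 1)
      else transpose (int i) (int i + 1) \<circ> transpose (- int i) (- (int i + 1)))"

definition cox_word :: "nat list \<Rightarrow> int \<Rightarrow> int" where
  "cox_word ws = foldr (\<lambda>i \<sigma>. cox_gen i \<circ> \<sigma>) ws id"

definition cox_length :: "nat \<Rightarrow> (int \<Rightarrow> int) \<Rightarrow> nat" where
  "cox_length n \<pi> = (LEAST l. \<exists>ws. length ws = l \<and> set ws \<subseteq> {..<n} \<and> cox_word ws = \<pi>)"

primrec flag_gen :: "nat \<Rightarrow> int \<Rightarrow> int" where
  "flag_gen 0 = cox_gen 0"
| "flag_gen (Suc i) = cox_gen (Suc i) \<circ> flag_gen i"

text \<open>\<open>flag_product k n\<close> is \<open>t\<^sub>n\<^sub>-\<^sub>1 ^ k\<^sub>n\<^sub>-\<^sub>1 \<cdots> t\<^sub>1 ^ k\<^sub>1 t\<^sub>0 ^ k\<^sub>0\<close>, where \<open>t\<^sub>i\<close> is \<open>flag_gen i\<close>.\<close>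

primrec flag_product :: "(nat \<Rightarrow> nat) \<Rightarrow> nat \<Rightarrow> int \<Rightarrow> int" where
  "flag_product k 0 = id"
| "flag_product k (Suc n) = (flag_gen n ^^ k n) \<circ> flag_product k n"

text \<open>
  Requiring \<open>k i = 0\<close> for \<open>i \<ge> n\<close> makes the tuple \<open>(k\<^sub>0, \<dots>, k\<^sub>n\<^sub>-\<^sub>1)\<close> a unique function on the
  naturals; the value is meaningful for \<open>\<pi> \<in> signed_perms n\<close>.
\<close>

definition flag_exponents :: "nat \<Rightarrow> (int \<Rightarrow> int) \<Rightarrow> nat \<Rightarrow> nat" where
  "flag_exponents n \<pi> =
     (THE k. (\<forall>i<n. k i < 2 * (i + 1)) \<and> (\<forall>i\<ge>n. k i = 0) \<and> \<pi> = flag_product k n)"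

definition flag_major :: "nat \<Rightarrow> (int \<Rightarrow> int) \<Rightarrow> nat" where
  "flag_major n \<pi> = (\<Sum>i<n. flag_exponents n \<pi> i)"

end

theory Submission
  imports Defs
begin

text \<open>
  Write \<open>B\<^sub>n\<close> for \<open>signed_perms n\<close>, so that \<open>B\<^sub>n\<close> is the stabiliser of the point \<open>n + 1\<close> in \<open>B\<^sub>n\<^sub>+\<^sub>1\<close>.
  A left coset of this stabiliser consists of the signed permutations with a common value at
  \<open>n + 1\<close>, and there are \<open>2 (n + 1)\<close> such values. Hence any family \<open>r\<^sub>0, \<dots>, r\<^sub>2\<^sub>n\<^sub>+\<^sub>1\<close> in \<open>B\<^sub>n\<^sub>+\<^sub>1\<close> that
  takes each value once at \<open>n + 1\<close> is a transversal: every element of \<open>B\<^sub>n\<^sub>+\<^sub>1\<close> is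
  \<open>r\<^sub>a \<circ> u\<close> for exactly one \<open>a\<close> and one \<open>u \<in> B\<^sub>n\<close> (\<open>coset_decomposition\<close>).

  Both statistics are additive along such a decomposition, each for its own transversal:
  the value at \<open>r\<^sub>a \<circ> u\<close> is \<open>a\<close> plus the value at \<open>u\<close>. Both distributions therefore obey the
  same recursion in \<open>n\<close> (\<open>card_level_set_decomposition\<close>), and they agree for \<open>n = 0\<close>.

  For the flag major index the transversal consists of the powers of \<open>t\<^sub>n\<close>, which permutes all
  the \<open>2 (n + 1)\<close> signed points in one cycle, and additivity is the definition
  (\<open>flag_major_Suc\<close>).

  For the length it consists of the shortest element of each coset. The generators move the
  value \<open>v\<close> at \<open>n + 1\<close> along the path \<open>n + 1, n, \<dots>, 1, - 1, \<dots>, - (n + 1)\<close>; the \<open>a\<close>-th vertex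
  of the path is reached by a word of \<open>a\<close> letters. That no shorter word exists for
  \<open>r\<^sub>a \<circ> u\<close> than \<open>a\<close> letters followed by a reduced word of \<open>u\<close> comes from the fact that
  \<open>s\<^sub>i \<circ> r\<^sub>a\<close> is either \<open>r\<^sub>a\<^sub>+\<^sub>1\<close> or \<open>r\<^sub>a\<^sub>-\<^sub>1\<close>, or it is \<open>r\<^sub>a \<circ> s\<^sub>j\<close> for some \<open>j < n\<close>: each letter of a word
  contributes at most one to the position on the path or one letter to a word in \<open>B\<^sub>n\<close>
  (\<open>cox_word_factor\<close>, \<open>cox_length_Suc\<close>).
\<close>

section \<open>Signed permutations\<close>

abbreviation signed_points :: "nat \<Rightarrow> int set" where
  "signed_points n \<equiv> {- int n..int n} - {0}"

text \<open>
  Oddness extends to all integers, because both \<open>0\<close> and the points outside the range are fixed;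
  this removes the membership side conditions from later computations.
\<close>

lemma signed_perms_iff:
  "\<pi> \<in> signed_perms n \<longleftrightarrow> \<pi> permutes signed_points n \<and> (\<forall>j. \<pi> (- j) = - \<pi> j)"
proof -
  have "\<pi> (- j) = - \<pi> j"
    if "\<pi> permutes signed_points n" "\<forall>j \<in> signed_points n. \<pi> (- j) = - \<pi> j" for j
  proof (cases "j \<in> signed_points n")
    case False
    then have "- j \<notin> signed_points n" by auto
    with False show ?thesis using permutes_not_in[OF that(1)] by metis
  qed (use that in blast)
  then show ?thesis unfolding signed_perms_def by blast
qed

lemma finite_signed_perms: "finite (signed_perms n)"
  by (rule finite_subset[OF _ finite_permutations[of "signed_points n"]])
    (auto simp: signed_perms_def)

lemma signed_perms_0: "signed_perms 0 = {id}"
  by (auto simp: signed_perms_iff)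

lemma id_signed_perm: "id \<in> signed_perms n"
  by (simp add: signed_perms_iff permutes_id)

lemma comp_signed_perm:
  "\<pi> \<in> signed_perms n \<Longrightarrow> \<sigma> \<in> signed_perms n \<Longrightarrow> \<pi> \<circ> \<sigma> \<in> signed_perms n"
  by (auto simp: signed_perms_iff intro: permutes_compose)

lemma funpow_signed_perm: "\<pi> \<in> signed_perms n \<Longrightarrow> \<pi> ^^ k \<in> signed_perms n"
  by (induction k) (auto simp: id_signed_perm intro: comp_signed_perm)

lemma inv_signed_perm:
  assumes "\<pi> \<in> signed_perms n"
  shows "inv \<pi> \<in> signed_perms n"
proof -
  have p: "\<pi> permutes signed_points n" and odd: "\<And>j. \<pi> (- j) = - \<pi> j"
    using assms by (auto simp: signed_perms_iff)
  have "inv \<pi> (- j) = - inv \<pi> j" for j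
    using permutes_inverses[OF p] odd by metis
  then show ?thesis using permutes_inv[OF p] by (simp add: signed_perms_iff)
qed

lemma signed_perms_Suc_iff:
  "\<pi> \<in> signed_perms n \<longleftrightarrow> \<pi> \<in> signed_perms (Suc n) \<and> \<pi> (int n + 1) = int n + 1"
proof
  assume \<pi>: "\<pi> \<in> signed_perms n"
  have "signed_points n \<subseteq> signed_points (Suc n)" by auto
  then have "\<pi> permutes signed_points (Suc n)"
    using \<pi> permutes_subset unfolding signed_perms_iff by blast
  then show "\<pi> \<in> signed_perms (Suc n) \<and> \<pi> (int n + 1) = int n + 1"
    using \<pi> permutes_not_in[of \<pi> "signed_points n" "int n + 1"]
    unfolding signed_perms_iff by auto
next
  assume r: "\<pi> \<in> signed_perms (Suc n) \<and> \<pi> (int n + 1) = int n + 1"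
  have "\<pi> permutes signed_points n"
  proof (rule permutes_superset)
    show "\<pi> permutes signed_points (Suc n)" using r by (simp add: signed_perms_iff)
    fix x assume "x \<in> signed_points (Suc n) - signed_points n"
    then have "x = int n + 1 \<or> x = - (int n + 1)" by auto
    moreover have "\<pi> (- (int n + 1)) = - (int n + 1)"
      using r unfolding signed_perms_iff by metis
    ultimately show "\<pi> x = x" using r by auto
  qed
  then show "\<pi> \<in> signed_perms n" using r by (simp add: signed_perms_iff)
qed

section \<open>Coset decompositions and the counting recursion\<close>

text \<open>
  Evaluating \<open>r a \<circ> u\<close> at \<open>n + 1\<close>, which \<open>u\<close> fixes, recovers \<open>r a (n + 1)\<close>, hence \<open>a\<close>, hence \<open>u\<close>.
  Conversely, if \<open>a\<close> is chosen such that \<open>r a\<close> and \<open>\<pi>\<close> agree at \<open>n + 1\<close>, then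
  \<open>inv (r a) \<circ> \<pi>\<close> fixes \<open>n + 1\<close>.
\<close>

lemma coset_decomposition:
  assumes r: "\<And>a. a \<in> A \<Longrightarrow> r a \<in> signed_perms (Suc n)"
    and last_values: "bij_betw (\<lambda>a. r a (int n + 1)) A (signed_points (Suc n))"
  shows "bij_betw (\<lambda>(a, u). r a \<circ> u) (A \<times> signed_perms n) (signed_perms (Suc n))"
  unfolding bij_betw_def
proof
  have last: "(r a \<circ> u) (int n + 1) = r a (int n + 1)" if "u \<in> signed_perms n" for a u
    using that signed_perms_Suc_iff[of u n] by simp
  show "inj_on (\<lambda>(a, u). r a \<circ> u) (A \<times> signed_perms n)"
  proof (rule inj_onI, clarify)
    fix a u b w
    assume *: "a \<in> A" "u \<in> signed_perms n" "b \<in> A" "w \<in> signed_perms n" "r a \<circ> u = r b \<circ> w"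
    then have "r a (int n + 1) = r b (int n + 1)" using last by metis
    then have ab: "a = b" using last_values * by (auto simp: bij_betw_def dest: inj_onD)
    have "inj (r a)" using r[OF \<open>a \<in> A\<close>] by (auto simp: signed_perms_iff permutes_inj)
    then have "u = w" using * ab by (metis fun.inj_map_strong inj_def)
    then show "a = b \<and> u = w" using ab by simp
  qed
  show "(\<lambda>(a, u). r a \<circ> u) ` (A \<times> signed_perms n) = signed_perms (Suc n)"
  proof (rule equalityI; rule subsetI)
    fix \<pi> assume "\<pi> \<in> (\<lambda>(a, u). r a \<circ> u) ` (A \<times> signed_perms n)"
    then obtain a u where "a \<in> A" "u \<in> signed_perms n" "\<pi> = r a \<circ> u" by auto
    moreover from this have "u \<in> signed_perms (Suc n)" using signed_perms_Suc_iff by blast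
    ultimately show "\<pi> \<in> signed_perms (Suc n)" using r by (auto intro: comp_signed_perm)
  next
    fix \<pi> assume \<pi>: "\<pi> \<in> signed_perms (Suc n)"
    then have "\<pi> (int n + 1) \<in> signed_points (Suc n)"
      using permutes_in_image[of \<pi> "signed_points (Suc n)" "int n + 1"]
      by (auto simp: signed_perms_iff)
    then obtain a where a: "a \<in> A" "r a (int n + 1) = \<pi> (int n + 1)"
      using last_values unfolding bij_betw_def by (metis (no_types, lifting) imageE)
    have p: "r a permutes signed_points (Suc n)"
      using r[OF a(1)] by (simp add: signed_perms_iff)
    have "inv (r a) \<circ> \<pi> \<in> signed_perms (Suc n)"
      using \<pi> r[OF a(1)] by (intro comp_signed_perm inv_signed_perm)
    moreover have "(inv (r a) \<circ> \<pi>) (int n + 1) = int n + 1"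
      using a(2) permutes_inverses(2)[OF p] by (metis comp_apply)
    ultimately have "inv (r a) \<circ> \<pi> \<in> signed_perms n"
      using signed_perms_Suc_iff by blast
    then have "(a, inv (r a) \<circ> \<pi>) \<in> A \<times> signed_perms n" using a(1) by blast
    moreover have "\<pi> = (\<lambda>(a, u). r a \<circ> u) (a, inv (r a) \<circ> \<pi>)"
      using permutes_inverses(1)[OF p] by auto
    ultimately show "\<pi> \<in> (\<lambda>(a, u). r a \<circ> u) ` (A \<times> signed_perms n)"
      by (rule rev_image_eqI)
  qed
qed

text \<open>
  The right-hand side depends on \<open>f\<close> only through the sizes of its level sets, so two statistics
  with such a decomposition for the same \<open>m\<close> are equidistributed as soon as the
  statistics \<open>f\<close> below them are.
\<close>

lemma card_level_set_decomposition:
  fixes f :: "'a \<Rightarrow> nat" and g :: "'b \<Rightarrow> nat"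
  assumes bij: "bij_betw (\<lambda>(a, u). h a u) ({..<m} \<times> U) W"
    and g: "\<And>a u. a < m \<Longrightarrow> u \<in> U \<Longrightarrow> g (h a u) = a + f u"
    and fin: "finite U"
  shows "card {w \<in> W. g w = k} = (\<Sum>a \<in> {a. a < m \<and> a \<le> k}. card {u \<in> U. f u = k - a})"
proof -
  let ?S = "Sigma {a. a < m \<and> a \<le> k} (\<lambda>a. {u \<in> U. f u = k - a})"
  have "bij_betw (\<lambda>(a, u). h a u) ?S {w \<in> W. g w = k}"
    unfolding bij_betw_def
  proof
    have "?S \<subseteq> {..<m} \<times> U" by auto
    then show "inj_on (\<lambda>(a, u). h a u) ?S"
      using bij inj_on_subset unfolding bij_betw_def by blast
    have "W = (\<lambda>(a, u). h a u) ` ({..<m} \<times> U)" using bij by (simp add: bij_betw_def)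
    then show "(\<lambda>(a, u). h a u) ` ?S = {w \<in> W. g w = k}"
      using g by (force simp: image_iff)
  qed
  then have "card {w \<in> W. g w = k} = card ?S" by (rule bij_betw_same_card[symmetric])
  also have "\<dots> = (\<Sum>a \<in> {a. a < m \<and> a \<le> k}. card {u \<in> U. f u = k - a})"
    using fin by (intro card_SigmaI) auto
  finally show ?thesis .
qed

section \<open>The Coxeter generators\<close>

lemma cox_gen_apply:
  "cox_gen i j =
    (if i = 0 then if \<bar>j\<bar> = 1 then - j else j
     else if j = int i then int i + 1 else if j = int i + 1 then int i
     else if j = - int i then - int i - 1 else if j = - int i - 1 then - int i else j)"
  by (auto simp: cox_gen_def transpose_def)

lemma cox_gen_signed_perm:
  assumes "i < n"
  shows "cox_gen i \<in> signed_perms n"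
proof -
  have "cox_gen i permutes signed_points n"
    using assms unfolding cox_gen_def
    by (auto intro!: permutes_compose permutes_swap_id)
  moreover have "cox_gen i (- j) = - cox_gen i j" for j
    unfolding cox_gen_apply by auto
  ultimately show ?thesis by (simp add: signed_perms_iff)
qed

lemma cox_word_Nil: "cox_word [] = id"
  and cox_word_Cons: "cox_word (i # ws) = cox_gen i \<circ> cox_word ws"
  by (simp_all add: cox_word_def)

lemma cox_word_append: "cox_word (ws @ vs) = cox_word ws \<circ> cox_word vs"
  by (induction ws) (simp_all add: cox_word_Nil cox_word_Cons comp_assoc)

lemma cox_word_signed_perm: "set ws \<subseteq> {..<n} \<Longrightarrow> cox_word ws \<in> signed_perms n"
  by (induction ws)
    (auto simp: cox_word_Nil cox_word_Cons id_signed_perm intro: comp_signed_perm cox_gen_signed_perm)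

section \<open>The flag major index\<close>

lemma flag_gen_signed_perm: "flag_gen n \<in> signed_perms (Suc n)"
proof (induction n)
  case (Suc n)
  then have "flag_gen n \<in> signed_perms (Suc (Suc n))" using signed_perms_Suc_iff by blast
  then show ?case unfolding flag_gen.simps by (intro comp_signed_perm cox_gen_signed_perm) simp
qed (simp add: cox_gen_signed_perm)

lemma flag_product_signed_perm: "flag_product k n \<in> signed_perms n"
proof (induction n)
  case (Suc n)
  then have "flag_product k n \<in> signed_perms (Suc n)" using signed_perms_Suc_iff by blast
  then show ?case unfolding flag_product.simps
    by (intro comp_signed_perm funpow_signed_perm flag_gen_signed_perm)
qed (simp only: flag_product.simps id_signed_perm)

lemma flag_product_cong: "(\<And>i. i < n \<Longrightarrow> k i = k' i) \<Longrightarrow> flag_product k n = flag_product k' n"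
  by (induction n) auto

lemma flag_gen_apply:
  "flag_gen n j = (if \<bar>j\<bar> > int n + 1 \<or> j = 0 then j
     else if j = 1 then - (int n + 1) else if j = - 1 then int n + 1
     else j - sgn j)"
proof (induction n arbitrary: j)
  case 0
  then show ?case by (auto simp: cox_gen_apply sgn_if)
next
  case (Suc n)
  show ?case unfolding flag_gen.simps comp_apply Suc cox_gen_apply
    by (auto simp: sgn_if)
qed

text \<open>
  Starting at \<open>n + 1\<close>, the cycle of \<open>t\<^sub>n\<close> runs through \<open>n, \<dots>, 1\<close>, jumps to \<open>- (n + 1)\<close>, and
  then runs through \<open>- n, \<dots>, - 1\<close>.
\<close>

lemma flag_gen_power_last:
  "k < 2 * (n + 1) \<Longrightarrow> (flag_gen n ^^ k) (int n + 1) =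
     (if k \<le> n then int n + 1 - int k else int k - 2 * (int n + 1))"
proof (induction k)
  case (Suc k)
  then show ?case by (auto simp: flag_gen_apply sgn_if)
qed simp

lemma flag_decomposition:
  "bij_betw (\<lambda>(a, u). flag_gen n ^^ a \<circ> u) ({..<2 * (n + 1)} \<times> signed_perms n)
     (signed_perms (Suc n))"
proof (rule coset_decomposition)
  show "bij_betw (\<lambda>a. (flag_gen n ^^ a) (int n + 1)) {..<2 * (n + 1)} (signed_points (Suc n))"
    by (rule bij_betw_byWitness[where f' = "\<lambda>v. nat (if v > 0 then int n + 1 - v else v + 2 * (int n + 1))"])
      (auto simp: flag_gen_power_last split: if_splits)
qed (intro funpow_signed_perm flag_gen_signed_perm)

text \<open>
  The property that \<open>flag_exponents\<close> singles out with a definite description.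
\<close>

definition flag_tuple :: "nat \<Rightarrow> (int \<Rightarrow> int) \<Rightarrow> (nat \<Rightarrow> nat) \<Rightarrow> bool" where
  "flag_tuple n \<pi> k \<longleftrightarrow>
     (\<forall>i<n. k i < 2 * (i + 1)) \<and> (\<forall>i\<ge>n. k i = 0) \<and> \<pi> = flag_product k n"

lemma flag_tuple_Suc:
  assumes "a < 2 * (n + 1)" "flag_tuple n u k"
  shows "flag_tuple (Suc n) (flag_gen n ^^ a \<circ> u) (k(n := a))"
  using assms flag_product_cong[of n "k(n := a)" k] by (auto simp: flag_tuple_def less_Suc_eq)

lemma flag_tuple_exists: "\<pi> \<in> signed_perms n \<Longrightarrow> \<exists>k. flag_tuple n \<pi> k"
proof (induction n arbitrary: \<pi>)
  case 0
  then show ?case by (auto simp: signed_perms_0 flag_tuple_def)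
next
  case (Suc n)
  then have "\<pi> \<in> (\<lambda>(a, u). flag_gen n ^^ a \<circ> u) ` ({..<2 * (n + 1)} \<times> signed_perms n)"
    using flag_decomposition[of n] unfolding bij_betw_def by blast
  then obtain a u where "a < 2 * (n + 1)" "u \<in> signed_perms n" "\<pi> = flag_gen n ^^ a \<circ> u"
    by auto
  then show ?case using Suc.IH flag_tuple_Suc by metis
qed

text \<open>
  The leading exponent is determined by the value at \<open>n + 1\<close>, and cancelling it leaves the same
  problem for the remaining product. Resetting it to \<open>0\<close> turns a tuple for \<open>n + 1\<close> into one
  for \<open>n\<close>, where entries from index \<open>n\<close> on have to vanish.
\<close>

lemma flag_tuple_unique: "flag_tuple n \<pi> k \<Longrightarrow> flag_tuple n \<pi> k' \<Longrightarrow> k = k'"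
proof (induction n arbitrary: \<pi> k k')
  case 0
  then show ?case by (auto simp: flag_tuple_def)
next
  case (Suc n)
  have "flag_gen n ^^ k n \<circ> flag_product k n = flag_gen n ^^ k' n \<circ> flag_product k' n"
    using Suc.prems unfolding flag_tuple_def flag_product.simps by metis
  moreover have "k n < 2 * (n + 1)" "k' n < 2 * (n + 1)"
    using Suc.prems by (auto simp: flag_tuple_def)
  ultimately have "(k n, flag_product k n) = (k' n, flag_product k' n)"
    by (intro inj_onD[OF bij_betw_imp_inj_on[OF flag_decomposition[of n]]])
      (auto simp: flag_product_signed_perm)
  then have eq: "k n = k' n" "flag_product k n = flag_product k' n" by auto
  have "flag_tuple n (flag_product k n) (l(n := 0))"
    if "flag_tuple (Suc n) \<pi> l" "flag_product l n = flag_product k n" for l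
    using that flag_product_cong[of n "l(n := 0)" l] by (auto simp: flag_tuple_def)
  then have "k(n := 0) = k'(n := 0)"
    using Suc.IH Suc.prems eq(2) by metis
  then show ?case using eq(1) by (metis fun_upd_triv fun_upd_upd)
qed

lemma flag_exponents_eq: "flag_tuple n \<pi> k \<Longrightarrow> flag_exponents n \<pi> = k"
  unfolding flag_exponents_def flag_tuple_def[symmetric]
  using flag_tuple_unique by blast

lemma flag_major_Suc:
  assumes "a < 2 * (n + 1)" "u \<in> signed_perms n"
  shows "flag_major (Suc n) (flag_gen n ^^ a \<circ> u) = a + flag_major n u"
proof -
  obtain k where k: "flag_tuple n u k" using flag_tuple_exists assms(2) by blast
  show ?thesis
    unfolding flag_major_def flag_exponents_eq[OF k]
      flag_exponents_eq[OF flag_tuple_Suc[OF assms(1) k]]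
    by simp
qed

section \<open>The length function\<close>

text \<open>
  The shortest element of the coset with value \<open>v\<close> at \<open>n + 1\<close>: it maps \<open>1, \<dots>, n\<close> increasingly
  onto the positive integers up to \<open>n + 1\<close> other than \<open>\<bar>v\<bar>\<close>.
\<close>

definition coset_rep :: "nat \<Rightarrow> int \<Rightarrow> int \<Rightarrow> int" where
  "coset_rep n v j =
     (if \<bar>j\<bar> > int n + 1 then j else if j = int n + 1 then v else if j = - (int n + 1) then - v
      else if \<bar>j\<bar> < \<bar>v\<bar> then j else j + sgn j)"

text \<open>
  The exchange \<open>s\<^sub>i\<close> swaps \<open>\<bar>v\<bar>\<close> with a neighbour, so it turns the increasing map that omits \<open>\<bar>v\<bar>\<close>
  into the increasing map that omits that neighbour; \<open>s\<^sub>0\<close> only changes the sign of \<open>v = \<plusminus>1\<close>.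
\<close>

lemma cox_gen_coset_rep_moved:
  assumes "i \<le> n" "v \<in> signed_points (Suc n)" "cox_gen i v \<noteq> v"
  shows "cox_gen i \<circ> coset_rep n v = coset_rep n (cox_gen i v)"
proof
  fix j
  have "cox_gen i (coset_rep n v j) = coset_rep n (cox_gen i v) j"
  proof (cases "i = 0")
    case True
    then have v: "v = 1 \<or> v = - 1" "cox_gen i v = - v"
      using assms(3) unfolding cox_gen_apply by (simp_all split: if_splits, linarith)
    define N where "N = int n"
    then have N: "N \<ge> 0" by simp
    show ?thesis
      using v(1) N unfolding v(2) unfolding cox_gen_apply if_P[OF True] coset_rep_def sgn_if
        N_def[symmetric]
      by (elim disjE) auto
  next
    case False
    define I N where "I = int i" and "N = int n"
    have IN: "I > 0" "I \<le> N" using False assms by (auto simp: I_def N_def)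
    have g: "cox_gen i k = (if k = I then I + 1 else if k = I + 1 then I
        else if k = - I then - I - 1 else if k = - I - 1 then - I else k)" for k
      unfolding cox_gen_apply I_def using False by simp
    consider "N + 1 < \<bar>j\<bar>" | "j = N + 1" | "j = - (N + 1)" | "\<bar>j\<bar> \<le> N" by linarith
    then show ?thesis
    proof cases
      case 4
      then have rep: "coset_rep n u j = (if \<bar>j\<bar> < \<bar>u\<bar> then j else j + sgn j)" for u
        by (auto simp: coset_rep_def N_def)
      consider "v = I" "cox_gen i v = I + 1" | "v = I + 1" "cox_gen i v = I"
        | "v = - I" "cox_gen i v = - I - 1" | "v = - I - 1" "cox_gen i v = - I"
        using assms(3) IN(1) g by metis
      then show ?thesis
        unfolding rep by cases (use IN in \<open>auto simp: g sgn_if\<close>)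
    qed (use IN in \<open>auto simp: coset_rep_def N_def g\<close>)
  qed
  then show "(cox_gen i \<circ> coset_rep n v) j = coset_rep n (cox_gen i v) j" by simp
qed

text \<open>
  If \<open>s\<^sub>i\<close> fixes \<open>v\<close>, then \<open>s\<^sub>i\<close> acts on values other than \<open>\<plusminus>v\<close>. Pulling it back along the
  increasing map from \<open>1, \<dots>, n\<close> gives a generator again: the index is unchanged below \<open>\<bar>v\<bar>\<close>
  and drops by one above it. The pair exchanged by \<open>s\<^sub>i\<close> never straddles \<open>\<bar>v\<bar>\<close>, as it is adjacent.
\<close>

lemma cox_gen_coset_rep_fixed:
  assumes "i \<le> n" "v \<in> signed_points (Suc n)" "cox_gen i v = v"
  obtains i' where "i' < n" "cox_gen i \<circ> coset_rep n v = coset_rep n v \<circ> cox_gen i'"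
proof -
  let ?i = "if int i < \<bar>v\<bar> then i else i - 1"
  define I N where "I = int i" and "N = int n"
  have IN: "I \<le> N" "v \<noteq> 0" "\<bar>v\<bar> \<le> N + 1" using assms by (auto simp: I_def N_def)
  have pos: "i = 0 \<and> 1 < \<bar>v\<bar> \<or> i > 0 \<and> I + 1 < \<bar>v\<bar> \<or> \<bar>v\<bar> < I"
    using assms(3) IN(2) unfolding cox_gen_apply I_def by (smt (verit) gr_zeroI of_nat_0)
  have less: "?i < n" using pos IN by (auto simp: I_def N_def)
  have "cox_gen i (coset_rep n v j) = coset_rep n v (cox_gen ?i j)" for j
    using pos
  proof (elim disjE conjE)
    assume v: "i = 0" "1 < \<bar>v\<bar>"
    then have idx: "?i = i" by simp
    show ?thesis
      using v(2) IN
      unfolding idx unfolding cox_gen_apply if_P[OF v(1)] coset_rep_def N_def[symmetric] sgn_if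
      by (smt (verit))
  next
    assume v: "i > 0" "I + 1 < \<bar>v\<bar>"
    then have idx: "?i = i" "i \<noteq> 0" "I > 0" by (auto simp: I_def)
    show ?thesis
      using v IN idx(3)
      unfolding idx(1)
      unfolding cox_gen_apply if_not_P[OF idx(2)]
        coset_rep_def I_def[symmetric] N_def[symmetric] sgn_if
      by (smt (verit))
  next
    assume v: "\<bar>v\<bar> < I"
    then have idx: "?i = i - 1" "i \<noteq> 0" "i - 1 \<noteq> 0" "int (i - 1) = I - 1"
      using IN(2) by (auto simp: I_def)
    show ?thesis
      using v IN
      unfolding idx(1)
      unfolding cox_gen_apply if_not_P[OF idx(2)] if_not_P[OF idx(3)] idx(4)
        coset_rep_def I_def[symmetric] N_def[symmetric] sgn_if
      by (smt (verit))
  qed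
  then have "cox_gen i \<circ> coset_rep n v = coset_rep n v \<circ> cox_gen ?i"
    by (simp add: fun_eq_iff)
  with less show ?thesis by (rule that)
qed

text \<open>
  The vertices of the path \<open>n + 1, n, \<dots>, 1, - 1, \<dots>, - (n + 1)\<close>, numbered from \<open>0\<close>; the index \<open>a\<close>
  will be the length of the corresponding coset representative.
\<close>

definition coset_value :: "nat \<Rightarrow> nat \<Rightarrow> int" where
  "coset_value n a = (if a \<le> n then int n + 1 - int a else int n - int a)"

lemma coset_value_bij: "bij_betw (coset_value n) {..<2 * (n + 1)} (signed_points (Suc n))"
  by (rule bij_betw_byWitness[where f' = "\<lambda>v. nat (if v > 0 then int n + 1 - v else int n - v)"])
    (auto simp: coset_value_def split: if_splits)

lemma coset_value_in: "a < 2 * (n + 1) \<Longrightarrow> coset_value n a \<in> signed_points (Suc n)"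
  using bij_betwE[OF coset_value_bij] by blast

lemma cox_gen_coset_value_up:
  assumes "Suc a < 2 * (n + 1)"
  obtains i where "i \<le> n" "cox_gen i (coset_value n a) = coset_value n (Suc a)"
    "cox_gen i (coset_value n a) \<noteq> coset_value n a"
proof
  let ?i = "nat \<bar>int n - int a\<bar>"
  show "?i \<le> n" using assms by auto
  show "cox_gen ?i (coset_value n a) = coset_value n (Suc a)"
    using assms by (auto simp: cox_gen_apply coset_value_def)
  then show "cox_gen ?i (coset_value n a) \<noteq> coset_value n a"
    by (auto simp: coset_value_def)
qed

text \<open>
  A generator moves a vertex of the path only to a neighbour. The bound \<open>b \<le> Suc a\<close> is the half
  of this that limits how fast words can climb.
\<close>

lemma cox_gen_coset_value_moved:
  assumes "i \<le> n" "a < 2 * (n + 1)" "cox_gen i (coset_value n a) \<noteq> coset_value n a"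
  obtains b where "b < 2 * (n + 1)" "b \<le> Suc a" "cox_gen i (coset_value n a) = coset_value n b"
proof -
  have "\<exists>b. b < 2 * (n + 1) \<and> b \<le> Suc a \<and> cox_gen i (coset_value n a) = coset_value n b"
  proof (cases "cox_gen i (coset_value n a) < coset_value n a")
    (* The path is decreasing, so a smaller value is the next vertex. *)
    case True
    then show ?thesis
      using assms by (intro exI[of _ "Suc a"]) (auto simp: cox_gen_apply coset_value_def split: if_splits)
  next
    case False
    then show ?thesis
      using assms by (intro exI[of _ "a - 1"]) (auto simp: cox_gen_apply coset_value_def split: if_splits)
  qed
  then show ?thesis using that by blast
qed

lemma coset_rep_first: "coset_rep n (coset_value n 0) = id"
  by (auto simp: fun_eq_iff coset_rep_def coset_value_def)

lemma coset_rep_word: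
  "a < 2 * (n + 1) \<Longrightarrow>
     \<exists>ws. length ws = a \<and> set ws \<subseteq> {..<Suc n} \<and> cox_word ws = coset_rep n (coset_value n a)"
proof (induction a)
  case 0
  show ?case by (intro exI[of _ "[]"]) (simp only: cox_word_Nil coset_rep_first, simp)
next
  case (Suc a)
  then obtain ws where ws: "length ws = a" "set ws \<subseteq> {..<Suc n}"
    "cox_word ws = coset_rep n (coset_value n a)" by auto
  obtain i where i: "i \<le> n" "cox_gen i (coset_value n a) = coset_value n (Suc a)"
    "cox_gen i (coset_value n a) \<noteq> coset_value n a"
    using cox_gen_coset_value_up[OF Suc.prems] by blast
  have "cox_word (i # ws) = coset_rep n (coset_value n (Suc a))"
    using cox_gen_coset_rep_moved[OF i(1) coset_value_in i(3)] Suc.prems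
    by (simp add: cox_word_Cons ws(3) i(2))
  then show ?case using ws i(1) by (intro exI[of _ "i # ws"]) auto
qed

lemma coset_rep_decomposition:
  "bij_betw (\<lambda>(a, u). coset_rep n (coset_value n a) \<circ> u) ({..<2 * (n + 1)} \<times> signed_perms n)
     (signed_perms (Suc n))"
proof (rule coset_decomposition)
  fix a assume "a \<in> {..<2 * (n + 1)}"
  then show "coset_rep n (coset_value n a) \<in> signed_perms (Suc n)"
    using coset_rep_word[of a n] cox_word_signed_perm by (metis lessThan_iff)
next
  show "bij_betw (\<lambda>a. coset_rep n (coset_value n a) (int n + 1)) {..<2 * (n + 1)}
    (signed_points (Suc n))"
    using coset_value_bij by (simp add: coset_rep_def)
qed

text \<open>
  This gives the lower bound for the length: a word in \<open>B\<^sub>n\<^sub>+\<^sub>1\<close> is rewritten as a coset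
  representative and a word in \<open>B\<^sub>n\<close> without increasing the total cost, by pushing the letters one
  at a time, from the right, through the representative.
\<close>

lemma cox_word_factor:
  assumes "set ws \<subseteq> {..<Suc n}"
  shows "\<exists>a vs. a < 2 * (n + 1) \<and> set vs \<subseteq> {..<n} \<and> a + length vs \<le> length ws \<and>
    cox_word ws = coset_rep n (coset_value n a) \<circ> cox_word vs"
  using assms
proof (induction ws)
  case Nil
  have "cox_word [] = coset_rep n (coset_value n 0) \<circ> cox_word []"
    unfolding coset_rep_first by simp
  then show ?case by (intro exI[of _ 0] exI[of _ "[]"]) simp
next
  case (Cons i ws)
  then obtain a vs where IH: "a < 2 * (n + 1)" "set vs \<subseteq> {..<n}" "a + length vs \<le> length ws"
    "cox_word ws = coset_rep n (coset_value n a) \<circ> cox_word vs"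
    by (metis insert_subset list.simps(15))
  have i: "i \<le> n" using Cons.prems by auto
  let ?v = "coset_value n a"
  have word: "cox_word (i # ws) = (cox_gen i \<circ> coset_rep n ?v) \<circ> cox_word vs"
    by (simp add: cox_word_Cons IH(4) comp_assoc)
  show ?case
  proof (cases "cox_gen i ?v = ?v")
    case True
    then obtain i' where "i' < n" "cox_gen i \<circ> coset_rep n ?v = coset_rep n ?v \<circ> cox_gen i'"
      using cox_gen_coset_rep_fixed[OF i coset_value_in[OF IH(1)]] by metis
    moreover from this have "cox_word (i # ws) = coset_rep n ?v \<circ> cox_word (i' # vs)"
      by (metis word cox_word_Cons comp_assoc)
    ultimately show ?thesis
      using IH(1-3) by (intro exI[of _ a] exI[of _ "i' # vs"]) simp
  next
    case False
    then obtain b where "b < 2 * (n + 1)" "b \<le> Suc a" "cox_gen i ?v = coset_value n b"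
      using cox_gen_coset_value_moved[OF i IH(1)] by metis
    moreover from this have "cox_word (i # ws) = coset_rep n (coset_value n b) \<circ> cox_word vs"
      using word cox_gen_coset_rep_moved[OF i coset_value_in[OF IH(1)] False] by metis
    ultimately show ?thesis
      using IH(2,3) by (intro exI[of _ b] exI[of _ vs]) simp
  qed
qed

lemma cox_length_le: "set ws \<subseteq> {..<n} \<Longrightarrow> cox_length n (cox_word ws) \<le> length ws"
  unfolding cox_length_def by (rule Least_le) blast

lemma signed_perm_word:
  "\<pi> \<in> signed_perms n \<Longrightarrow> \<exists>ws. set ws \<subseteq> {..<n} \<and> cox_word ws = \<pi>"
proof (induction n arbitrary: \<pi>)
  case 0
  then have "\<pi> = cox_word []" unfolding signed_perms_0 cox_word_Nil by blast
  then show ?case by (intro exI[of _ "[]"]) simp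
next
  case (Suc n)
  then have "\<pi> \<in> (\<lambda>(a, u). coset_rep n (coset_value n a) \<circ> u) `
      ({..<2 * (n + 1)} \<times> signed_perms n)"
    using coset_rep_decomposition[of n] unfolding bij_betw_def by blast
  then obtain a u where a: "a < 2 * (n + 1)" "u \<in> signed_perms n"
    "\<pi> = coset_rep n (coset_value n a) \<circ> u"
    by auto
  obtain vs where vs: "set vs \<subseteq> {..<n}" "cox_word vs = u" using Suc.IH[OF a(2)] by auto
  obtain ws where ws: "set ws \<subseteq> {..<Suc n}" "cox_word ws = coset_rep n (coset_value n a)"
    using coset_rep_word[OF a(1)] by auto
  show ?case
    using vs ws a(3) by (intro exI[of _ "ws @ vs"]) (auto simp: cox_word_append)
qed

lemma reduced_word:
  assumes "\<pi> \<in> signed_perms n"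
  obtains ws where "set ws \<subseteq> {..<n}" "cox_word ws = \<pi>" "length ws = cox_length n \<pi>"
proof -
  have "\<exists>l ws. length ws = l \<and> set ws \<subseteq> {..<n} \<and> cox_word ws = \<pi>"
    using signed_perm_word[OF assms] by blast
  then have "\<exists>ws. length ws = cox_length n \<pi> \<and> set ws \<subseteq> {..<n} \<and> cox_word ws = \<pi>"
    unfolding cox_length_def by (rule LeastI_ex)
  then show ?thesis using that by blast
qed

text \<open>
  Concatenating words bounds the length from above. From below, a reduced word of the product is
  factored by \<open>cox_word_factor\<close>, and uniqueness of the decomposition identifies the factors.
\<close>

lemma cox_length_Suc:
  assumes a: "a < 2 * (n + 1)" and u: "u \<in> signed_perms n"
  shows "cox_length (Suc n) (coset_rep n (coset_value n a) \<circ> u) = a + cox_length n u"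
    (is "cox_length _ ?\<pi> = _")
proof (rule antisym)
  obtain ws where ws: "length ws = a" "set ws \<subseteq> {..<Suc n}"
    "cox_word ws = coset_rep n (coset_value n a)"
    using coset_rep_word[OF a] by blast
  obtain vs where vs: "set vs \<subseteq> {..<n}" "cox_word vs = u" "length vs = cox_length n u"
    using reduced_word[OF u] by blast
  have "set (ws @ vs) \<subseteq> {..<Suc n}" using ws(2) vs(1) by auto
  from cox_length_le[OF this] show "cox_length (Suc n) ?\<pi> \<le> a + cox_length n u"
    by (simp add: cox_word_append ws vs)
next
  have "?\<pi> \<in> signed_perms (Suc n)"
    using coset_rep_decomposition[of n] a u by (auto simp: bij_betw_def)
  then obtain ws where ws: "set ws \<subseteq> {..<Suc n}" "cox_word ws = ?\<pi>"
    "length ws = cox_length (Suc n) ?\<pi>"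
    by (rule reduced_word)
  obtain b vs where b: "b < 2 * (n + 1)" "set vs \<subseteq> {..<n}" "b + length vs \<le> length ws"
    "?\<pi> = coset_rep n (coset_value n b) \<circ> cox_word vs"
    using cox_word_factor[OF ws(1)] ws(2) by metis
  have "(a, u) = (b, cox_word vs)"
    by (rule inj_onD[OF bij_betw_imp_inj_on[OF coset_rep_decomposition[of n]]])
      (use a u b cox_word_signed_perm in auto)
  then show "a + cox_length n u \<le> cox_length (Suc n) ?\<pi>"
    using b(3) ws(3) cox_length_le[OF b(2)] by simp
qed

section \<open>Equidistribution\<close>

theorem theorem2:
  fixes n k :: nat
  assumes "n \<ge> 1"
  shows "card {\<pi> \<in> signed_perms n. flag_major n \<pi> = k} =
         card {\<pi> \<in> signed_perms n. cox_length n \<pi> = k}"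
proof -
  have "card {\<pi> \<in> signed_perms n. flag_major n \<pi> = k} =
        card {\<pi> \<in> signed_perms n. cox_length n \<pi> = k}" for n k
  proof (induction n arbitrary: k)
    case 0
    have "cox_length 0 \<pi> = flag_major 0 \<pi>" if "\<pi> \<in> signed_perms 0" for \<pi>
    proof -
      have "\<pi> = cox_word []" using that unfolding signed_perms_0 cox_word_Nil by blast
      then show ?thesis using cox_length_le[of "[]" 0] by (simp add: flag_major_def)
    qed
    then show ?case by (metis (mono_tags, lifting) Collect_cong)
  next
    case (Suc n)
    have "card {\<pi> \<in> signed_perms (Suc n). flag_major (Suc n) \<pi> = k} =
        (\<Sum>a \<in> {a. a < 2 * (n + 1) \<and> a \<le> k}. card {u \<in> signed_perms n. flag_major n u = k - a})"
      by (rule card_level_set_decomposition[OF flag_decomposition _ finite_signed_perms])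
        (rule flag_major_Suc)
    also have "\<dots> =
        (\<Sum>a \<in> {a. a < 2 * (n + 1) \<and> a \<le> k}. card {u \<in> signed_perms n. cox_length n u = k - a})"
      unfolding Suc.IH ..
    also have "\<dots> = card {\<pi> \<in> signed_perms (Suc n). cox_length (Suc n) \<pi> = k}"
      by (rule card_level_set_decomposition[OF coset_rep_decomposition _ finite_signed_perms, symmetric])
        (rule cox_length_Suc)
    finally show ?case .
  qed
  then show ?thesis .
qed

end
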